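(* Let $d\ge 2$ be an integer and, for integers $N\ge 1$, let $\Lambda_d(N)$ denote the dimension of the free Lie algebra over $d$ generators truncated at degree $N$. Then $$\Lambda_d(N)\sim \frac{d^{N+1}}{(d-1)N}\qquad\text{as } N\to\infty .$$
   Context: Let $\mathfrak L(\mathbb R^d)$ be the free (real) Lie algebra over $d$ generators, graded by degree (each generator has degree $1$), and let $\mathfrak L_N(\mathbb R^d)$ be its truncation at degree $N$, i.e. the direct sum of its homogeneous components of degrees $1,\dots,N$. Then $\Lambda_d(N):=\dim \mathfrak L_N(\mathbb R^d)$. The notation $a_N\sim b_N$ means $a_N/b_N\to 1$. *)

theory Defs
  imports
    "HOL-Analysis.Finite_Function_Topology"
    "HOL-Library.Cardinality"
    "HOL-Library.Landau_Symbols"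
begin

section \<open>Real Lie algebras\<close>

class lie_algebra = real_vector +
  fixes lie_bracket :: "'a \<Rightarrow> 'a \<Rightarrow> 'a"
  assumes lie_bracket_add_left: "lie_bracket (x + y) z = lie_bracket x z + lie_bracket y z"
    and lie_bracket_add_right: "lie_bracket x (y + z) = lie_bracket x y + lie_bracket x z"
    and lie_bracket_scaleR_left: "lie_bracket (c *\<^sub>R x) y = c *\<^sub>R lie_bracket x y"
    and lie_bracket_scaleR_right: "lie_bracket x (c *\<^sub>R y) = c *\<^sub>R lie_bracket x y"
    and lie_bracket_self: "lie_bracket x x = 0"
    and lie_jacobi: "lie_bracket x (lie_bracket y z) + lie_bracket y (lie_bracket z x)
                       + lie_bracket z (lie_bracket x y) = 0"

definition lie_hom :: "('a::lie_algebra \<Rightarrow> 'b::lie_algebra) \<Rightarrow> bool" where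
  "lie_hom h \<longleftrightarrow> linear h \<and> (\<forall>x y. h (lie_bracket x y) = lie_bracket (h x) (h y))"


section \<open>The free nonassociative algebra\<close>

datatype 'a free_magma = Gen 'a | Prd "'a free_magma" "'a free_magma"

fun magma_degree :: "'a free_magma \<Rightarrow> nat" where
  "magma_degree (Gen a) = 1"
| "magma_degree (Prd s t) = magma_degree s + magma_degree t"

fun magma_eval :: "('a \<Rightarrow> 'b) \<Rightarrow> ('b \<Rightarrow> 'b \<Rightarrow> 'b) \<Rightarrow> 'a free_magma \<Rightarrow> 'b" where
  "magma_eval g m (Gen a) = g a"
| "magma_eval g m (Prd s t) = m (magma_eval g m s) (magma_eval g m t)"

text \<open>Finitely supported real functions on the free magma, with the bilinear extension of the
  magma product.\<close>

type_synonym 'a free_nonassoc = "'a free_magma \<Rightarrow>\<^sub>0 real"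

lift_definition na_mult :: "'a free_nonassoc \<Rightarrow> 'a free_nonassoc \<Rightarrow> 'a free_nonassoc"
  is "\<lambda>f g u. case u of Gen a \<Rightarrow> 0 | Prd s t \<Rightarrow> f s * g t"
proof -
  fix f g :: "'a free_magma \<Rightarrow> real"
  assume "finite {x. f x \<noteq> 0}" "finite {x. g x \<noteq> 0}"
  then have "finite ((\<lambda>(s, t). Prd s t) ` ({x. f x \<noteq> 0} \<times> {x. g x \<noteq> 0}))"
    by blast
  moreover have "{u. (case u of Gen a \<Rightarrow> 0 | Prd s t \<Rightarrow> f s * g t) \<noteq> 0}
      \<subseteq> (\<lambda>(s, t). Prd s t) ` ({x. f x \<noteq> 0} \<times> {x. g x \<noteq> 0})"
    by (force simp: image_iff split: free_magma.splits)
  ultimately show "finite {u. (case u of Gen a \<Rightarrow> 0 | Prd s t \<Rightarrow> f s * g t) \<noteq> 0}"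
    by (rule rev_finite_subset)
qed

lemma lookup_scaleR_pm: "Poly_Mapping.lookup (c *\<^sub>R p) t = c * Poly_Mapping.lookup p t"
  for p :: "'a \<Rightarrow>\<^sub>0 real"
proof -
  have "finite {i. c *\<^sub>R Poly_Mapping.lookup p i \<noteq> 0}"
    by (rule finite_subset[of _ "Poly_Mapping.keys p"]) (auto simp: in_keys_iff)
  then show ?thesis
    by (simp add: scaleR_poly_mapping_def)
qed

lemma lookup_na_mult_Gen: "Poly_Mapping.lookup (na_mult p q) (Gen a) = 0"
  by transfer simp

lemma lookup_na_mult_Prd: "Poly_Mapping.lookup (na_mult p q) (Prd s t) =
  Poly_Mapping.lookup p s * Poly_Mapping.lookup q t"
  by transfer simp

lemmas na_lookup = lookup_na_mult_Gen lookup_na_mult_Prd lookup_scaleR_pm lookup_add lookup_minus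

lemma na_eqI:
  assumes "\<And>a. Poly_Mapping.lookup p (Gen a) = Poly_Mapping.lookup q (Gen a)"
    and "\<And>s t. Poly_Mapping.lookup p (Prd s t) = Poly_Mapping.lookup q (Prd s t)"
  shows "p = q"
  by (rule poly_mapping_eqI) (metis assms free_magma.exhaust)

lemma na_mult_add_left: "na_mult (p + q) r = na_mult p r + na_mult q r"
  and na_mult_add_right: "na_mult r (p + q) = na_mult r p + na_mult r q"
  and na_mult_diff_left: "na_mult (p - q) r = na_mult p r - na_mult q r"
  and na_mult_diff_right: "na_mult r (p - q) = na_mult r p - na_mult r q"
  and na_mult_scaleR_left: "na_mult (c *\<^sub>R p) r = c *\<^sub>R na_mult p r"
  and na_mult_scaleR_right: "na_mult r (c *\<^sub>R p) = c *\<^sub>R na_mult r p"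
  by (rule na_eqI; simp add: na_lookup algebra_simps)+


section \<open>The free Lie algebra\<close>

text \<open>The two-sided ideal generated by the elements \<open>x \<cdot> x\<close> and
  \<open>x \<cdot> (y \<cdot> z) + y \<cdot> (z \<cdot> x) + z \<cdot> (x \<cdot> y)\<close>.\<close>

inductive_set lie_ideal :: "'a free_nonassoc set" where
  square: "na_mult x x \<in> lie_ideal"
| jacobi: "na_mult x (na_mult y z) + na_mult y (na_mult z x) + na_mult z (na_mult x y) \<in> lie_ideal"
| add: "x \<in> lie_ideal \<Longrightarrow> y \<in> lie_ideal \<Longrightarrow> x + y \<in> lie_ideal"
| scale: "x \<in> lie_ideal \<Longrightarrow> c *\<^sub>R x \<in> lie_ideal"
| mult_left: "x \<in> lie_ideal \<Longrightarrow> na_mult y x \<in> lie_ideal"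
| mult_right: "x \<in> lie_ideal \<Longrightarrow> na_mult x y \<in> lie_ideal"

lemma lie_ideal_zero: "0 \<in> lie_ideal"
  using lie_ideal.scale[OF lie_ideal.square, of 0] by simp

lemma lie_ideal_uminus: "x \<in> lie_ideal \<Longrightarrow> - x \<in> lie_ideal"
  using lie_ideal.scale[of x "-1"] by simp

lemma lie_ideal_diff: "x \<in> lie_ideal \<Longrightarrow> y \<in> lie_ideal \<Longrightarrow> x - y \<in> lie_ideal"
  using lie_ideal.add[OF _ lie_ideal_uminus] by fastforce

definition lie_cong :: "'a free_nonassoc \<Rightarrow> 'a free_nonassoc \<Rightarrow> bool" where
  "lie_cong x y \<longleftrightarrow> x - y \<in> lie_ideal"

lemma equivp_lie_cong: "equivp lie_cong"
proof (rule equivpI)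
  show "reflp lie_cong"
    by (auto intro!: reflpI simp: lie_cong_def lie_ideal_zero)
  show "symp lie_cong"
    using lie_ideal_uminus by (fastforce intro!: sympI simp: lie_cong_def)
  show "transp lie_cong"
    using lie_ideal.add by (fastforce intro!: transpI simp: lie_cong_def)
qed

quotient_type 'a free_lie = "'a free_nonassoc" / lie_cong
  by (rule equivp_lie_cong)

instantiation free_lie :: (type) lie_algebra
begin

lift_definition zero_free_lie :: "'a free_lie" is "0" .

lift_definition plus_free_lie :: "'a free_lie \<Rightarrow> 'a free_lie \<Rightarrow> 'a free_lie" is "(+)"
  by (auto simp: lie_cong_def add_diff_add intro: lie_ideal.add)

lift_definition minus_free_lie :: "'a free_lie \<Rightarrow> 'a free_lie \<Rightarrow> 'a free_lie" is "(-)"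
proof -
  fix a b c d :: "'a free_nonassoc"
  assume "lie_cong a b" "lie_cong c d"
  then have "(a - b) - (c - d) \<in> lie_ideal"
    by (auto simp: lie_cong_def intro: lie_ideal_diff)
  then show "lie_cong (a - c) (b - d)"
    by (simp add: lie_cong_def algebra_simps)
qed

lift_definition uminus_free_lie :: "'a free_lie \<Rightarrow> 'a free_lie" is "uminus"
  using lie_ideal_uminus by (fastforce simp: lie_cong_def)

lift_definition scaleR_free_lie :: "real \<Rightarrow> 'a free_lie \<Rightarrow> 'a free_lie" is "scaleR"
  by (auto simp: lie_cong_def simp flip: scaleR_diff_right intro: lie_ideal.scale)

lift_definition lie_bracket_free_lie :: "'a free_lie \<Rightarrow> 'a free_lie \<Rightarrow> 'a free_lie" is "na_mult"
proof -
  fix a b c d :: "'a free_nonassoc"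
  assume "lie_cong a b" "lie_cong c d"
  then have "na_mult (a - b) c + na_mult b (c - d) \<in> lie_ideal"
    by (auto simp: lie_cong_def intro: lie_ideal.intros)
  then show "lie_cong (na_mult a c) (na_mult b d)"
    by (simp add: lie_cong_def na_mult_diff_left na_mult_diff_right)
qed

instance
proof
  fix a b c :: "'a free_lie" and r s :: real
  show "a + b + c = a + (b + c)" "a + b = b + a" "0 + a = a" "- a + a = 0" "a - b = a + - b"
    by (transfer; simp add: lie_cong_def lie_ideal_zero algebra_simps)+
  show "r *\<^sub>R (a + b) = r *\<^sub>R a + r *\<^sub>R b" "(r + s) *\<^sub>R a = r *\<^sub>R a + s *\<^sub>R a"
    "r *\<^sub>R s *\<^sub>R a = (r * s) *\<^sub>R a" "1 *\<^sub>R a = a"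
    by (transfer; simp add: lie_cong_def lie_ideal_zero algebra_simps)+
  show "lie_bracket (a + b) c = lie_bracket a c + lie_bracket b c"
    "lie_bracket a (b + c) = lie_bracket a b + lie_bracket a c"
    "lie_bracket (r *\<^sub>R a) b = r *\<^sub>R lie_bracket a b"
    "lie_bracket a (r *\<^sub>R b) = r *\<^sub>R lie_bracket a b"
    by (transfer; simp add: lie_cong_def lie_ideal_zero na_mult_add_left na_mult_add_right
        na_mult_scaleR_left na_mult_scaleR_right)+
  show "lie_bracket a a = 0"
    by transfer (simp add: lie_cong_def lie_ideal.square)
  show "lie_bracket a (lie_bracket b c) + lie_bracket b (lie_bracket c a)
          + lie_bracket c (lie_bracket a b) = 0"
    by transfer (simp add: lie_cong_def lie_ideal.jacobi)
qed

end

lift_definition lie_gen :: "'a \<Rightarrow> 'a free_lie" is "\<lambda>a. Poly_Mapping.single (Gen a) 1" .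

text \<open>The iterated Lie bracket of generators described by a parenthesised word.\<close>

definition lie_monomial :: "'a free_magma \<Rightarrow> 'a free_lie" where
  "lie_monomial = magma_eval lie_gen lie_bracket"


section \<open>Grading and truncation\<close>

definition free_lie_component :: "nat \<Rightarrow> 'a free_lie set" where
  "free_lie_component n = span (lie_monomial ` {t. magma_degree t = n})"

text \<open>The sum of the components is direct, see \<open>free_lie_component_independent\<close> below.\<close>

definition free_lie_trunc :: "nat \<Rightarrow> 'a free_lie set" where
  "free_lie_trunc N =
     {\<Sum>n = 1..N. x n | x :: nat \<Rightarrow> 'a free_lie. \<forall>n \<in> {1..N}. x n \<in> free_lie_component n}"

text \<open>The dimension of the truncated free Lie algebra over the generators \<open>'a\<close>; the number of
  generators is \<open>CARD('a)\<close>. The spanning sets of the components are finite by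
  \<open>finite_magma_degree\<close>, so \<open>dim\<close> is not the default value \<open>0\<close> of an
  infinite-dimensional space.\<close>

lemma magma_degree_pos: "magma_degree t > 0"
  by (induction t) auto

lemma finite_magma_degree: "finite {t :: 'a::finite free_magma. magma_degree t \<le> n}"
proof (induction n)
  case 0
  have "{t :: 'a free_magma. magma_degree t \<le> 0} = {}"
    using magma_degree_pos by (auto simp: neq0_conv[symmetric] simp del: neq0_conv)
  then show ?case
    by (simp only: finite.emptyI)
next
  case (Suc n)
  let ?S = "{t :: 'a free_magma. magma_degree t \<le> n}"
  have "t \<in> range Gen \<union> (\<lambda>(s, t). Prd s t) ` (?S \<times> ?S)" if "magma_degree t \<le> Suc n" for t
  proof (cases t)
    case (Prd u v)
    then have "u \<in> ?S" "v \<in> ?S"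
      using that magma_degree_pos[of u] magma_degree_pos[of v] by auto
    then show ?thesis
      using Prd by force
  qed simp
  moreover have "finite (range Gen \<union> (\<lambda>(s, t). Prd s t) ` (?S \<times> ?S))"
    using Suc.IH by simp
  ultimately show ?case
    by (elim rev_finite_subset) blast
qed

definition free_lie_trunc_dim :: "'a::finite itself \<Rightarrow> nat \<Rightarrow> nat" where
  "free_lie_trunc_dim _ N = dim (free_lie_trunc N :: 'a free_lie set)"


section \<open>Universal property\<close>

definition na_extend :: "('a \<Rightarrow> 'b::lie_algebra) \<Rightarrow> 'a free_nonassoc \<Rightarrow> 'b" where
  "na_extend f p = (\<Sum>t \<in> Poly_Mapping.keys p.
     Poly_Mapping.lookup p t *\<^sub>R magma_eval f lie_bracket t)"

lemma na_extend_superset: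
  assumes "finite S" "Poly_Mapping.keys p \<subseteq> S"
  shows "na_extend f p = (\<Sum>t \<in> S. Poly_Mapping.lookup p t *\<^sub>R magma_eval f lie_bracket t)"
  unfolding na_extend_def by (rule sum.mono_neutral_left) (use assms in \<open>auto simp: in_keys_iff\<close>)

lemma na_extend_add: "na_extend f (p + q) = na_extend f p + na_extend f q"
proof -
  let ?S = "Poly_Mapping.keys p \<union> Poly_Mapping.keys q"
  have "Poly_Mapping.keys (p + q) \<subseteq> ?S"
    by (rule Poly_Mapping.keys_add)
  then show ?thesis
    by (simp add: na_extend_superset[of ?S] lookup_add scaleR_add_left sum.distrib)
qed

lemma na_extend_scaleR: "na_extend f (c *\<^sub>R p) = c *\<^sub>R na_extend f p"
proof -
  have "Poly_Mapping.keys (c *\<^sub>R p) \<subseteq> Poly_Mapping.keys p"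
    by (auto simp: in_keys_iff lookup_scaleR_pm)
  then show ?thesis
    by (simp add: na_extend_superset[of "Poly_Mapping.keys p"] lookup_scaleR_pm scaleR_sum_right)
qed

lemma linear_na_extend: "linear (na_extend f)"
  by (rule linearI) (simp_all add: na_extend_add na_extend_scaleR)

lemma linear_lie_bracket_left: "linear (\<lambda>x::'b::lie_algebra. lie_bracket x y)"
  and linear_lie_bracket_right: "linear (\<lambda>y::'b::lie_algebra. lie_bracket x y)"
  by (auto intro!: linearI simp: lie_bracket_add_left lie_bracket_add_right
      lie_bracket_scaleR_left lie_bracket_scaleR_right)

lemma na_extend_mult: "na_extend f (na_mult p q) = lie_bracket (na_extend f p) (na_extend f q)"
proof -
  let ?e = "magma_eval f lie_bracket"
  let ?P = "\<lambda>(s, t). Prd s t"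
  let ?S = "?P ` (Poly_Mapping.keys p \<times> Poly_Mapping.keys q)"
  have sub: "Poly_Mapping.keys (na_mult p q) \<subseteq> ?S"
  proof
    fix u assume u: "u \<in> Poly_Mapping.keys (na_mult p q)"
    then show "u \<in> ?S"
      by (cases u) (auto simp: in_keys_iff na_lookup)
  qed
  have inj: "inj_on ?P (Poly_Mapping.keys p \<times> Poly_Mapping.keys q)"
    by (auto intro: inj_onI)
  have "na_extend f (na_mult p q) = (\<Sum>u \<in> ?S. Poly_Mapping.lookup (na_mult p q) u *\<^sub>R ?e u)"
    by (rule na_extend_superset[OF _ sub]) simp
  also have "\<dots> = (\<Sum>(s, t) \<in> Poly_Mapping.keys p \<times> Poly_Mapping.keys q.
      (Poly_Mapping.lookup p s * Poly_Mapping.lookup q t) *\<^sub>R lie_bracket (?e s) (?e t))"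
    by (subst sum.reindex[OF inj]) (auto simp: na_lookup intro!: sum.cong)
  also have "\<dots> = (\<Sum>s \<in> Poly_Mapping.keys p. \<Sum>t \<in> Poly_Mapping.keys q.
      (Poly_Mapping.lookup p s * Poly_Mapping.lookup q t) *\<^sub>R lie_bracket (?e s) (?e t))"
    by (simp add: sum.cartesian_product)
  also have "\<dots> = lie_bracket (na_extend f p) (na_extend f q)"
    unfolding na_extend_def
    by (simp only: linear_sum[OF linear_lie_bracket_left] lie_bracket_scaleR_left
        linear_sum[OF linear_lie_bracket_right] lie_bracket_scaleR_right scaleR_sum_right
        scaleR_scaleR mult.commute) (rule sum.swap)
  finally show ?thesis .
qed

lemma na_extend_lie_ideal: "p \<in> lie_ideal \<Longrightarrow> na_extend f p = 0"
proof (induction p rule: lie_ideal.induct)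
  case (mult_left x y)
  then show ?case
    using linear_0[OF linear_lie_bracket_right] by (simp add: na_extend_mult)
next
  case (mult_right x y)
  then show ?case
    using linear_0[OF linear_lie_bracket_left] by (simp add: na_extend_mult)
qed (simp_all add: na_extend_mult na_extend_add na_extend_scaleR lie_bracket_self lie_jacobi)

lift_definition free_lie_extend :: "('a \<Rightarrow> 'b::lie_algebra) \<Rightarrow> 'a free_lie \<Rightarrow> 'b" is na_extend
  using na_extend_lie_ideal linear_diff[OF linear_na_extend]
  by (metis eq_iff_diff_eq_0 lie_cong_def)

lemma lie_hom_free_lie_extend: "lie_hom (free_lie_extend f)"
  unfolding lie_hom_def
proof (intro conjI allI linearI)
  fix x y :: "'a free_lie" and c :: real
  show "free_lie_extend f (x + y) = free_lie_extend f x + free_lie_extend f y"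
    by transfer (rule na_extend_add)
  show "free_lie_extend f (c *\<^sub>R x) = c *\<^sub>R free_lie_extend f x"
    by transfer (rule na_extend_scaleR)
  show "free_lie_extend f (lie_bracket x y)
      = lie_bracket (free_lie_extend f x) (free_lie_extend f y)"
    by transfer (rule na_extend_mult)
qed

lemma free_lie_extend_gen: "free_lie_extend f (lie_gen a) = f a"
  by transfer (simp add: na_extend_def)

lemma lie_hom_monomial:
  "lie_hom h \<Longrightarrow> h (lie_monomial t) = magma_eval (\<lambda>a. h (lie_gen a)) lie_bracket t"
  by (induction t) (simp_all add: lie_monomial_def lie_hom_def)

lemma lie_monomial_eq:
  "lie_monomial t = abs_free_lie (Poly_Mapping.single t 1)"
proof (induction t)
  case (Gen a)
  show ?case
    by (simp add: lie_monomial_def lie_gen.abs_eq)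
next
  case (Prd s t)
  have "na_mult (Poly_Mapping.single s 1) (Poly_Mapping.single t 1)
      = Poly_Mapping.single (Prd s t) (1::real)"
    by (rule na_eqI) (auto simp: na_lookup lookup_single when_def)
  with Prd show ?case
    by (simp add: lie_monomial_def lie_bracket_free_lie.abs_eq)
qed

lemma span_lie_monomial: "span (range lie_monomial) = UNIV"
proof -
  have "x \<in> span (range lie_monomial)" for x :: "'a free_lie"
  proof -
    obtain p where p: "x = abs_free_lie p"
      by (metis Quotient3_free_lie Quotient3_abs_rep)
    have lin: "linear abs_free_lie"
      by (rule linearI) (simp_all add: plus_free_lie.abs_eq scaleR_free_lie.abs_eq)
    have "p = (\<Sum>t \<in> Poly_Mapping.keys p. Poly_Mapping.lookup p t *\<^sub>R Poly_Mapping.single t 1)"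
      by (rule poly_mapping_eqI)
        (simp add: lookup_sum lookup_scaleR_pm lookup_single when_def in_keys_iff
          if_distrib[of "\<lambda>x. _ * x"] sum.delta cong: if_cong)
    then have "x = abs_free_lie
        (\<Sum>t \<in> Poly_Mapping.keys p. Poly_Mapping.lookup p t *\<^sub>R Poly_Mapping.single t 1)"
      using p by simp
    also have "\<dots> = (\<Sum>t \<in> Poly_Mapping.keys p. Poly_Mapping.lookup p t *\<^sub>R lie_monomial t)"
      by (simp add: linear_sum[OF lin] linear_scale[OF lin] lie_monomial_eq)
    finally show ?thesis
      by (simp add: span_sum span_scale span_base)
  qed
  then show ?thesis by auto
qed

theorem free_lie_universal:
  fixes f :: "'a \<Rightarrow> 'b::lie_algebra"
  shows "\<exists>!h :: 'a free_lie \<Rightarrow> 'b. lie_hom h \<and> (\<forall>a. h (lie_gen a) = f a)"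
proof (rule ex1I[of _ "free_lie_extend f"])
  show "lie_hom (free_lie_extend f) \<and> (\<forall>a. free_lie_extend f (lie_gen a) = f a)"
    by (simp add: lie_hom_free_lie_extend free_lie_extend_gen)
next
  fix h :: "'a free_lie \<Rightarrow> 'b"
  assume h: "lie_hom h \<and> (\<forall>a. h (lie_gen a) = f a)"
  have "h x = free_lie_extend f x" for x
  proof (rule linear_eq_on[of h "free_lie_extend f" x "range lie_monomial"])
    show "linear h" "linear (free_lie_extend f)"
      using h lie_hom_free_lie_extend by (auto simp: lie_hom_def)
    show "x \<in> span (range lie_monomial)"
      by (simp add: span_lie_monomial)
    fix b :: "'a free_lie"
    assume "b \<in> range lie_monomial"
    then show "h b = free_lie_extend f b"
      using h lie_hom_free_lie_extend[of f]
      by (auto simp: lie_hom_monomial free_lie_extend_gen)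
  qed
  then show "h = free_lie_extend f" by auto
qed


section \<open>Independence of the homogeneous components\<close>

lemma magma_eval_scaled:
  "magma_eval (\<lambda>a. 2 *\<^sub>R lie_gen a) lie_bracket t = 2 ^ magma_degree t *\<^sub>R lie_monomial t"
  by (induction t)
    (simp_all add: lie_monomial_def lie_bracket_scaleR_left lie_bracket_scaleR_right power_add
      mult.commute)

lemma free_lie_component_independent:
  fixes x :: "nat \<Rightarrow> 'a free_lie"
  assumes "\<And>n. n \<in> {1..N} \<Longrightarrow> x n \<in> free_lie_component n"
    and "(\<Sum>n = 1..N. x n) = 0"
    and "n \<in> {1..N}"
  shows "x n = 0"
  using assms
proof (induction N arbitrary: x n)
  case (Suc N)
  define h :: "'a free_lie \<Rightarrow> 'a free_lie" where "h = free_lie_extend (\<lambda>a. 2 *\<^sub>R lie_gen a)"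
  have hom: "lie_hom h"
    unfolding h_def by (rule lie_hom_free_lie_extend)
  then have lin: "linear h"
    by (simp add: lie_hom_def)
  have eig: "h y = 2 ^ k *\<^sub>R y" if "y \<in> free_lie_component k" for y k
  proof (rule linear_eq_on[OF lin, of "\<lambda>y. 2 ^ k *\<^sub>R y"])
    show "linear (\<lambda>y :: 'a free_lie. 2 ^ k *\<^sub>R y)"
      by (auto intro!: linearI simp: scaleR_add_right)
    show "y \<in> span (lie_monomial ` {t. magma_degree t = k})"
      using that by (simp add: free_lie_component_def)
    fix b :: "'a free_lie"
    assume "b \<in> lie_monomial ` {t. magma_degree t = k}"
    then show "h b = 2 ^ k *\<^sub>R b"
      using lie_hom_monomial[OF hom]
      by (auto simp: h_def free_lie_extend_gen magma_eval_scaled)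
  qed
  define z where "z k = (2 ^ k - 2 ^ Suc N :: real) *\<^sub>R x k" for k
  have "(\<Sum>k = 1..Suc N. 2 ^ k *\<^sub>R x k) = h (\<Sum>k = 1..Suc N. x k)"
    unfolding linear_sum[OF lin] using Suc.prems(1) by (intro sum.cong eig[symmetric]) auto
  also have "\<dots> = 0"
    unfolding Suc.prems(2) by (rule linear_0[OF lin])
  finally have 1: "(\<Sum>k = 1..Suc N. 2 ^ k *\<^sub>R x k) = 0" .
  have "(\<Sum>k = 1..N. z k) = (\<Sum>k = 1..Suc N. z k)"
    by (simp add: z_def)
  also have "\<dots> = (\<Sum>k = 1..Suc N. 2 ^ k *\<^sub>R x k) - 2 ^ Suc N *\<^sub>R (\<Sum>k = 1..Suc N. x k)"
    by (simp only: z_def scaleR_diff_left sum_subtractf scaleR_sum_right)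
  also have "\<dots> = 0"
    unfolding 1 Suc.prems(2) by simp
  finally have "(\<Sum>k = 1..N. z k) = 0" .
  moreover have "z k \<in> free_lie_component k" if "k \<in> {1..N}" for k
    using Suc.prems(1)[of k] that
    by (auto simp: z_def free_lie_component_def intro: span_scale)
  ultimately have z0: "z k = 0" if "k \<in> {1..N}" for k
    using Suc.IH[of z k] that by blast
  have x0: "x k = 0" if "k \<in> {1..N}" for k
  proof -
    have "(2::real) ^ k < 2 ^ Suc N"
      using that by (intro power_strict_increasing) auto
    then show ?thesis
      using z0[OF that] by (simp add: z_def)
  qed
  then have "(\<Sum>k = 1..N. x k) = 0"
    by (intro sum.neutral) auto
  then have "x (Suc N) = 0"
    using Suc.prems(2) by simp
  then show ?case
    using x0 Suc.prems(3) by (cases "n = Suc N") auto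
qed simp

end

theory Submission
  imports Defs "HOL-Library.List_Lexorder" "HOL-Analysis.Uniform_Limit"
begin

text \<open>The dimension is computed exactly: it is the number of Lyndon words of length at most \<open>N\<close>
  over an ordered alphabet with \<open>d\<close> letters. To each word of length at least two belongs its
  standard factorization into a prefix and its smallest proper suffix; iterating it on a Lyndon
  word \<open>w\<close> yields an iterated bracket \<open>P w\<close>.

  The elements \<open>P w\<close> span. In any Lie algebra, Jacobi's identity rewrites \<open>[P u, P v]\<close> as a
  combination of elements \<open>P w\<close> with \<open>w\<close> Lyndon and of length \<open>|u| + |v|\<close>
  (\<open>lie_bracket_lyndon_less\<close>), so every iterated bracket of generators lies in their span
  (\<open>magma_eval_in_span_lyndon\<close>).

  The elements \<open>P w\<close> are independent. The universal property maps the free Lie algebra to the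
  free associative algebra with the commutator bracket, and there \<open>P w\<close> becomes \<open>w\<close> plus a
  combination of larger words of the same length (\<open>leading_word_lyndon_bracket\<close>). Together the
  two parts give \<open>free_lie_trunc_dim_eq\<close>.

  Let \<open>l n\<close> be the number of Lyndon words of length \<open>n\<close>. Lyndon words are the strictly smallest
  rotations of words without a nontrivial period, so \<open>n * l n\<close> is the number of such words; it
  is at most \<open>d ^ n\<close> and differs from \<open>d ^ n\<close> by at most the sum of \<open>d ^ i\<close> over \<open>i \<le> n div 2\<close>.
  Hence \<open>n * l n / d ^ n\<close> tends to \<open>1\<close>. The partial sums of such a sequence are dominated by
  their last terms, which form a geometric series of ratio \<open>1 / d\<close> up to factors tending to \<open>1\<close>
  (\<open>sum_asymp_equiv_power_over_index\<close>); this yields the factor \<open>d / (d - 1)\<close>.\<close>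


section \<open>Lyndon words\<close>

lemma lex_append_cancel: "x @ y < x @ z \<longleftrightarrow> y < z"
  for x y z :: "'b::linorder list"
  by (induction x) auto

lemma lex_append_le: "x \<le> x @ y"
  for x y :: "'b::linorder list"
  by (induction x) auto

text \<open>If \<open>x < y\<close> lexicographically, then either \<open>x\<close> is a prefix of \<open>y\<close>, or the two words differ
  at some common position, in which case the inequality survives appending anything to either
  side.\<close>

lemma lex_less_cases:
  fixes x y :: "'b::linorder list"
  assumes "x < y"
  obtains t where "y = x @ t" | "\<And>u v. x @ u < y @ v"
proof -
  have "(\<exists>t. y = x @ t) \<or> (\<forall>u v. x @ u < y @ v)"
    using assms
  proof (induction x arbitrary: y)
    case (Cons a x)
    then show ?case by (cases y) auto
  qed simp
  then show thesis
    using that by blast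
qed

lemma lex_append_mono:
  fixes x y :: "'b::linorder list"
  assumes "x < y" "length y \<le> length x"
  shows "x @ u < y @ v"
  using assms(1)
proof (cases rule: lex_less_cases)
  case (1 t)
  then show ?thesis
    using assms by auto
qed

text \<open>A Lyndon word is a nonempty word that is lexicographically strictly smaller than each of
  its proper nonempty suffixes.\<close>

definition lyndon :: "'b::linorder list \<Rightarrow> bool" where
  "lyndon w \<longleftrightarrow> w \<noteq> [] \<and> (\<forall>u v. w = u @ v \<longrightarrow> u \<noteq> [] \<longrightarrow> v \<noteq> [] \<longrightarrow> w < v)"

lemma lyndonD: "lyndon (u @ v) \<Longrightarrow> u \<noteq> [] \<Longrightarrow> v \<noteq> [] \<Longrightarrow> u @ v < v"
  by (auto simp: lyndon_def)

lemma lyndon_not_Nil: "lyndon w \<Longrightarrow> w \<noteq> []"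
  by (simp add: lyndon_def)

lemma lyndon_singleton: "lyndon [a]"
  by (auto simp: lyndon_def Cons_eq_append_conv)

text \<open>The standard factorization of a word of length at least two: the suffix is the
  lexicographically smallest proper nonempty suffix, the prefix is what remains. For a Lyndon
  word this suffix is also its longest proper Lyndon suffix. On words of length at most one
  \<open>std_suffix\<close> is the minimum of an empty set and has no meaning.\<close>

definition std_suffix :: "'b::linorder list \<Rightarrow> 'b list" where
  "std_suffix w = Min ((\<lambda>k. drop k w) ` {0<..<length w})"

definition std_prefix :: "'b::linorder list \<Rightarrow> 'b list" where
  "std_prefix w = take (length w - length (std_suffix w)) w"

lemma std_suffix_le: "std_suffix (u @ v) \<le> v" if "u \<noteq> []" "v \<noteq> []"
proof -
  have "drop (length u) (u @ v) \<in> (\<lambda>k. drop k (u @ v)) ` {0<..<length (u @ v)}"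
    using that by (intro imageI) auto
  then show ?thesis
    unfolding std_suffix_def by (intro Min_le) auto
qed

lemma std_factorization:
  assumes "1 < length w"
  shows "std_prefix w @ std_suffix w = w" "std_prefix w \<noteq> []" "std_suffix w \<noteq> []"
proof -
  have "std_suffix w \<in> (\<lambda>k. drop k w) ` {0<..<length w}"
    unfolding std_suffix_def using assms by (intro Min_in) (auto simp: image_is_empty)
  then obtain k where k: "0 < k" "k < length w" "std_suffix w = drop k w"
    by auto
  then have "std_prefix w = take k w"
    by (simp add: std_prefix_def)
  with k show "std_prefix w @ std_suffix w = w" "std_prefix w \<noteq> []" "std_suffix w \<noteq> []"
    by auto
qed

lemma std_factors_eqI:
  assumes "u \<noteq> []" "v \<noteq> []" "\<And>a b. u @ v = a @ b \<Longrightarrow> a \<noteq> [] \<Longrightarrow> b \<noteq> [] \<Longrightarrow> v \<le> b"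
  shows "std_suffix (u @ v) = v" "std_prefix (u @ v) = u"
proof -
  have "1 < length (u @ v)"
    using assms(1,2) by (cases u; cases v) auto
  note std = std_factorization[OF this]
  show "std_suffix (u @ v) = v"
  proof (rule antisym)
    show "std_suffix (u @ v) \<le> v"
      by (rule std_suffix_le) fact+
    show "v \<le> std_suffix (u @ v)"
      by (rule assms(3)[OF std(1)[symmetric] std(2,3)])
  qed
  then show "std_prefix (u @ v) = u"
    by (simp add: std_prefix_def)
qed

lemma lyndon_std_suffix:
  assumes "1 < length w"
  shows "lyndon (std_suffix w)"
  unfolding lyndon_def
proof (intro conjI allI impI)
  note std = std_factorization[OF assms]
  show "std_suffix w \<noteq> []" by (rule std)
  fix a b assume ab: "std_suffix w = a @ b" "a \<noteq> []" "b \<noteq> []"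
  then have "w = (std_prefix w @ a) @ b"
    using std(1) by simp
  then have "std_suffix w \<le> b"
    using std_suffix_le[of "std_prefix w @ a" b] ab by simp
  moreover have "std_suffix w \<noteq> b"
    using ab by simp
  ultimately show "std_suffix w < b" by simp
qed

text \<open>Let \<open>w = p @ v\<close> be the standard factorization and suppose \<open>p = a @ b\<close> with \<open>b < p\<close>. If \<open>b\<close>
  and \<open>p\<close> differ at a common position, then \<open>b @ v < w\<close>, although \<open>w\<close> is Lyndon. If \<open>p = b @ t\<close>,
  then \<open>w < b @ v\<close> gives \<open>t @ v < v\<close>, although \<open>v\<close> is the smallest suffix.\<close>

lemma lyndon_std_prefix:
  assumes "lyndon w" "1 < length w"
  shows "lyndon (std_prefix w)"
  unfolding lyndon_def
proof (intro conjI allI impI)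
  note std = std_factorization[OF assms(2)]
  show "std_prefix w \<noteq> []" by (rule std)
  let ?v = "std_suffix w"
  fix a b assume ab: "std_prefix w = a @ b" "a \<noteq> []" "b \<noteq> []"
  then have w: "w = a @ (b @ ?v)"
    using std(1) by simp
  have less: "w < b @ ?v"
    using lyndonD[of a "b @ ?v"] w assms(1) ab std(3) by simp
  show "std_prefix w < b"
  proof (rule ccontr)
    assume "\<not> std_prefix w < b"
    moreover have "std_prefix w \<noteq> b"
      using ab by simp
    ultimately have gt: "b < std_prefix w" by simp
    then show False
    proof (cases rule: lex_less_cases)
      case (1 t)
      have w': "w = b @ (t @ ?v)"
        using 1 std(1) by simp
      then have "t @ ?v < ?v"
        using less lex_append_cancel[of b "t @ ?v" ?v] by simp
      moreover have "?v \<le> t @ ?v"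
        using std_suffix_le[of b "t @ ?v"] w' ab(3) std(3) by simp
      ultimately show False by simp
    next
      case 2
      then show False
        using less std(1) by (metis less_asym)
    qed
  qed
qed

lemma std_suffix_greater:
  assumes "lyndon w" "1 < length w"
  shows "w < std_suffix w"
  using lyndonD[of "std_prefix w" "std_suffix w"] std_factorization[OF assms(2)] assms(1) by simp

lemma std_prefix_less_suffix:
  assumes "lyndon w" "1 < length w"
  shows "std_prefix w < std_suffix w"
  using std_suffix_greater[OF assms] std_factorization(1)[OF assms(2)]
    lex_append_le[of "std_prefix w" "std_suffix w"] by (metis le_less_trans)

lemma lex_append_less_right:
  fixes u v :: "'b::linorder list"
  assumes "u < v" "lyndon v" "u \<noteq> []"
  shows "u @ v < v"
  using assms(1)
proof (cases rule: lex_less_cases)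
  case (1 t)
  then have "t \<noteq> []"
    using assms(1) by auto
  then have "v < t"
    using lyndonD[of u t] assms 1 by simp
  then have "u @ v < u @ t"
    by (simp add: lex_append_cancel)
  then show ?thesis
    using 1 by simp
next
  case 2
  then show ?thesis
    by (metis append_Nil2)
qed

lemma lyndon_append:
  assumes "lyndon u" "lyndon v" "u < v"
  shows "lyndon (u @ v)"
  unfolding lyndon_def
proof (intro conjI allI impI)
  show "u @ v \<noteq> []"
    using lyndon_not_Nil[OF assms(1)] by simp
  fix a b assume ab: "u @ v = a @ b" "a \<noteq> []" "b \<noteq> []"
  have uv: "u @ v < v"
    using lex_append_less_right assms lyndon_not_Nil by blast
  from ab(1) consider c where "u = a @ c" "b = c @ v" | c where "a = u @ c" "v = c @ b"
    by (auto simp: append_eq_append_conv2)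
  then show "u @ v < b"
  proof cases
    case 1
    show ?thesis
    proof (cases "c = []")
      case False
      then have "u < c"
        using 1 lyndonD[of a c] assms(1) ab by simp
      then have "u @ v < c @ v"
        using 1 by (intro lex_append_mono) auto
      then show ?thesis
        using 1 by simp
    qed (use uv 1 in simp)
  next
    case 2
    then have "v \<le> b"
      using lyndonD[of c b] assms(2) ab by (cases "c = []") auto
    then show ?thesis
      using uv by simp
  qed
qed

text \<open>The criterion for a product of two Lyndon words to be already in standard factorization;
  the rewriting procedure below stops exactly at such pairs.\<close>

lemma std_factors_append:
  assumes "lyndon u" "lyndon v" "length u = 1 \<or> v \<le> std_suffix u"
  shows "std_suffix (u @ v) = v" "std_prefix (u @ v) = u"
proof -
  have "v \<le> b" if ab: "u @ v = a @ b" "a \<noteq> []" "b \<noteq> []" for a b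
  proof -
    from ab(1) consider c where "u = a @ c" "b = c @ v" | c where "a = u @ c" "v = c @ b"
      by (auto simp: append_eq_append_conv2)
    then show ?thesis
    proof cases
      case 1
      show ?thesis
      proof (cases "c = []")
        case False
        then have "length u \<noteq> 1"
          using 1 ab by (cases a; cases c) auto
        then have "v \<le> c"
          using assms(3) std_suffix_le[of a c] 1 ab False by auto
        also have "c \<le> c @ v"
          by (rule lex_append_le)
        finally show ?thesis
          using 1 by simp
      qed (use 1 in simp)
    next
      case 2
      then show ?thesis
        using lyndonD[of c b] assms(2) ab by (cases "c = []") auto
    qed
  qed
  note eqs = std_factors_eqI[OF lyndon_not_Nil[OF assms(1)] lyndon_not_Nil[OF assms(2)] this]
  show "std_suffix (u @ v) = v" "std_prefix (u @ v) = u"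
    using eqs by simp_all
qed


section \<open>Spanning by Lyndon brackets\<close>

lemma lie_bracket_antisym: "lie_bracket x y = - lie_bracket y (x::'c::lie_algebra)"
proof -
  have "lie_bracket (x + y) (x + y) = lie_bracket x y + lie_bracket y x"
    by (simp only: lie_bracket_add_left lie_bracket_add_right) (simp add: lie_bracket_self)
  then have "lie_bracket x y + lie_bracket y x = 0"
    by (metis lie_bracket_self)
  then show ?thesis
    by (simp add: eq_neg_iff_add_eq_0)
qed

lemma lie_bracket_leibniz:
  fixes x y z :: "'c::lie_algebra"
  shows "lie_bracket (lie_bracket x y) z
    = lie_bracket (lie_bracket x z) y + lie_bracket x (lie_bracket y z)"
proof -
  have "lie_bracket (lie_bracket x y) z = - lie_bracket z (lie_bracket x y)"
    by (rule lie_bracket_antisym)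
  moreover have "lie_bracket (lie_bracket x z) y = lie_bracket y (lie_bracket z x)"
    using lie_bracket_antisym[of "lie_bracket x z" y] lie_bracket_antisym[of x z]
      linear_neg[OF linear_lie_bracket_right[of y], of "lie_bracket z x"] by simp
  ultimately show ?thesis
    using lie_jacobi[of x y z] by (metis add.commute add_eq_0_iff)
qed

lemma lie_bracket_span:
  fixes B C :: "'c::lie_algebra set"
  assumes "p \<in> span B" "q \<in> span C"
    and "\<And>b c. b \<in> B \<Longrightarrow> c \<in> C \<Longrightarrow> lie_bracket b c \<in> span D"
  shows "lie_bracket p q \<in> span D"
proof -
  have sub1: "subspace {x. lie_bracket x c \<in> span D}" for c
    using linear_subspace_vimage[OF linear_lie_bracket_left subspace_span]
    by (simp add: vimage_def)
  have sub2: "subspace {x. lie_bracket c x \<in> span D}" for c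
    using linear_subspace_vimage[OF linear_lie_bracket_right subspace_span]
    by (simp add: vimage_def)
  have "lie_bracket p c \<in> span D" if "c \<in> C" for c
    using span_minimal[OF _ sub1, of B c] assms(1,3) that by blast
  then show ?thesis
    using span_minimal[OF _ sub2, of C p] assms(2) by blast
qed

text \<open>The parenthesised word obtained by iterating the standard factorization. Only nonempty words
  matter; the empty word gets an arbitrary generator.\<close>

function lyndon_tree :: "'b::linorder list \<Rightarrow> 'b free_magma" where
  "lyndon_tree w = (if length w \<le> 1 then Gen (hd w)
     else Prd (lyndon_tree (std_prefix w)) (lyndon_tree (std_suffix w)))"
  by auto

lemma length_std_factors:
  assumes "1 < length w"
  shows "length (std_prefix w) + length (std_suffix w) = length w"
    "length (std_prefix w) < length w" "length (std_suffix w) < length w"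
proof -
  note std = std_factorization[OF assms]
  show "length (std_prefix w) + length (std_suffix w) = length w"
    using std(1) by (metis length_append)
  then show "length (std_prefix w) < length w" "length (std_suffix w) < length w"
    using std(2,3) by (auto simp flip: length_greater_0_conv)
qed

lemma set_std_factors:
  assumes "1 < length w"
  shows "set (std_prefix w) \<union> set (std_suffix w) = set w"
  using std_factorization(1)[OF assms] by (metis set_append)

termination lyndon_tree
  by (relation "measure length") (auto simp: length_std_factors)

declare lyndon_tree.simps [simp del]

text \<open>The iterated Lie bracket attached to a word, with values in an arbitrary Lie algebra in
  which the letters are interpreted by \<open>g\<close>.\<close>

definition lyndon_bracket :: "('b::linorder \<Rightarrow> 'c::lie_algebra) \<Rightarrow> 'b list \<Rightarrow> 'c" where
  "lyndon_bracket g w = magma_eval g lie_bracket (lyndon_tree w)"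

lemma lyndon_bracket_singleton: "lyndon_bracket g [a] = g a"
  by (simp add: lyndon_bracket_def lyndon_tree.simps)

lemma lyndon_bracket_factors:
  "1 < length w \<Longrightarrow> lyndon_bracket g w
    = lie_bracket (lyndon_bracket g (std_prefix w)) (lyndon_bracket g (std_suffix w))"
  by (simp add: lyndon_bracket_def lyndon_tree.simps[of w])

lemma magma_degree_lyndon_tree: "w \<noteq> [] \<Longrightarrow> magma_degree (lyndon_tree w) = length w"
proof (induction w rule: lyndon_tree.induct)
  case (1 w)
  show ?case
  proof (cases "length w \<le> 1")
    case True
    then show ?thesis
      using "1.prems" by (cases w) (auto simp: lyndon_tree.simps)
  next
    case False
    then show ?thesis
      using 1 std_factorization[of w] length_std_factors(1)[of w]
      by (simp add: lyndon_tree.simps[of w])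
  qed
qed

text \<open>The Lyndon words of length \<open>n\<close> over the alphabet \<open>A\<close>.\<close>

definition lyndon_words :: "'b::linorder set \<Rightarrow> nat \<Rightarrow> 'b list set" where
  "lyndon_words A n = {w. lyndon w \<and> set w \<subseteq> A \<and> length w = n}"

text \<open>The bracket of two Lyndon brackets is a combination of Lyndon brackets of the same length.
  Let \<open>u < v\<close> have standard factorization \<open>u = a @ b\<close>. If \<open>v \<le> b\<close>, or \<open>u\<close> is a letter, then
  \<open>[P u, P v] = P (u @ v)\<close>. Otherwise \<open>[P u, P v] = [[P a, P v], P b] + [P a, [P b, P v]]\<close>, and
  the inner brackets are expanded by induction on the length. The bound on the standard suffixes
  in the conclusion makes the recursion terminate: each word \<open>w\<close> that comes out of an inner
  bracket satisfies \<open>w < std_suffix w \<le> v\<close>, and \<open>a < b < v\<close>, so that both arguments of the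
  remaining bracket are smaller than \<open>v\<close>. The second component of the measure counts the
  finitely many words of bounded length below \<open>v\<close>.\<close>

lemma lie_bracket_lyndon_less:
  fixes g :: "'b::linorder \<Rightarrow> 'c::lie_algebra"
  assumes "finite A" "lyndon u" "lyndon v" "set u \<subseteq> A" "set v \<subseteq> A" "u < v"
  shows "lie_bracket (lyndon_bracket g u) (lyndon_bracket g v) \<in> span (lyndon_bracket g `
    {w \<in> lyndon_words A (length u + length v). std_suffix w \<le> v})"
  using assms(2-6)
proof (induction "(u, v)" arbitrary: u v rule: wf_induct_rule[OF wf_measures[of
      "[\<lambda>(u, v). length u + length v,
        \<lambda>(u, v). card {x. set x \<subseteq> A \<and> length x \<le> length u + length v \<and> x < v}]"]])
  case (1 u v)
  let ?P = "lyndon_bracket g"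
  define S where "S n v = span (?P ` {w \<in> lyndon_words A n. std_suffix w \<le> v})" for n v
  define n where "n = length u + length v"
  have IH: "lie_bracket (?P x) (?P y) \<in> S (length x + length y) y"
    if "lyndon x" "lyndon y" "set x \<subseteq> A" "set y \<subseteq> A" "x < y"
      "length x + length y < n \<or> length x + length y = n \<and> y < v" for x y
  proof -
    have "card {z. set z \<subseteq> A \<and> length z \<le> n \<and> z < y}
        < card {z. set z \<subseteq> A \<and> length z \<le> n \<and> z < v}"
      if "y < v" "length x + length y = n"
    proof (rule psubset_card_mono)
      show "finite {z. set z \<subseteq> A \<and> length z \<le> n \<and> z < v}"
        by (rule finite_subset[OF _ finite_lists_length_le[OF assms(1), of n]]) auto
      have "y \<in> {z. set z \<subseteq> A \<and> length z \<le> n \<and> z < v}"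
        using that \<open>set y \<subseteq> A\<close> by auto
      then show "{z. set z \<subseteq> A \<and> length z \<le> n \<and> z < y}
          \<subset> {z. set z \<subseteq> A \<and> length z \<le> n \<and> z < v}"
        using that by auto
    qed
    then show ?thesis
      unfolding S_def using that by (intro 1(1)) (auto simp: n_def)
  qed
  \<comment> \<open>The order of the two arguments does not matter once both are below \<open>v\<close>.\<close>
  have below: "lie_bracket (?P x) (?P y) \<in> S n v"
    if xy: "lyndon x" "lyndon y" "set x \<subseteq> A" "set y \<subseteq> A" "x < v" "y < v" "length x + length y = n"
    for x y
  proof -
    have mono: "S n x \<subseteq> S n v" "S n y \<subseteq> S n v"
      unfolding S_def using xy by (intro span_mono; force)+
    consider "x < y" | "x = y" | "y < x" by fastforce
    then show ?thesis
    proof cases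
      case 1
      then show ?thesis
        using IH[of x y] xy mono by auto
    next
      case 2
      then show ?thesis
        by (simp add: lie_bracket_self S_def span_zero)
    next
      case 3
      then have "lie_bracket (?P y) (?P x) \<in> S n v"
        using IH[of y x] xy mono by (auto simp: add.commute)
      then have "- lie_bracket (?P y) (?P x) \<in> S n v"
        unfolding S_def by (rule span_neg)
      then show ?thesis
        using lie_bracket_antisym[of "?P x" "?P y"] by simp
    qed
  qed
  have "lie_bracket (?P u) (?P v) \<in> S n v"
  proof (cases "length u = 1 \<or> v \<le> std_suffix u")
    case True
    note std = std_factors_append[OF 1(2,3) True]
    have len: "1 < length (u @ v)"
      using lyndon_not_Nil[OF 1(2)] lyndon_not_Nil[OF 1(3)] by (cases u; cases v) auto
    have "?P (u @ v) = lie_bracket (?P u) (?P v)"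
      using lyndon_bracket_factors[OF len] std by simp
    moreover have "u @ v \<in> {w \<in> lyndon_words A n. std_suffix w \<le> v}"
      using lyndon_append[OF 1(2,3,6)] 1(4,5) std by (simp add: lyndon_words_def n_def)
    then have "?P (u @ v) \<in> S n v"
      unfolding S_def by (intro span_base imageI)
    ultimately show ?thesis by simp
  next
    case False
    then have len: "1 < length u"
      using lyndon_not_Nil[OF 1(2)] by (cases u) auto
    define a b where "a = std_prefix u" and "b = std_suffix u"
    have ab: "lyndon a" "lyndon b" "set a \<subseteq> A" "set b \<subseteq> A" "a < b" "b < v" "a < v"
      "length a + length b = length u" "length a < length u" "length b < length u"
      using lyndon_std_prefix[OF 1(2) len] lyndon_std_suffix[OF len] set_std_factors[OF len] 1(4)
        std_prefix_less_suffix[OF 1(2) len] False length_std_factors[OF len]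
      by (auto simp: a_def b_def)
    have pos: "length v > 0" "length a > 0" "length b > 0"
      using lyndon_not_Nil 1(3) ab by auto
    have w_below: "w < v"
      if "w \<in> {w \<in> lyndon_words A k. std_suffix w \<le> v}" "k > 1" for w k
      using that std_suffix_greater[of w] by (force simp: lyndon_words_def)
    have "lie_bracket (lie_bracket (?P a) (?P v)) (?P b)
        \<in> span (?P ` {w \<in> lyndon_words A n. std_suffix w \<le> v})"
    proof (rule lie_bracket_span)
      show "lie_bracket (?P a) (?P v) \<in>
          span (?P ` {w \<in> lyndon_words A (length a + length v). std_suffix w \<le> v})"
        using IH[of a v] ab 1 by (simp add: n_def S_def)
      show "?P b \<in> span {?P b}"
        by (simp add: span_base)
      fix x y assume "x \<in> ?P ` {w \<in> lyndon_words A (length a + length v). std_suffix w \<le> v}"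
        and "y \<in> {?P b}"
      then obtain w where w: "w \<in> {w \<in> lyndon_words A (length a + length v). std_suffix w \<le> v}"
        and xy: "x = ?P w" "y = ?P b" by blast
      moreover have "w < v"
        using w_below[OF w] pos by simp
      ultimately show "lie_bracket x y \<in> span (?P ` {w \<in> lyndon_words A n. std_suffix w \<le> v})"
        using below[of w b] ab by (simp add: S_def lyndon_words_def n_def)
    qed
    moreover have "lie_bracket (?P a) (lie_bracket (?P b) (?P v))
        \<in> span (?P ` {w \<in> lyndon_words A n. std_suffix w \<le> v})"
    proof (rule lie_bracket_span)
      show "lie_bracket (?P b) (?P v) \<in>
          span (?P ` {w \<in> lyndon_words A (length b + length v). std_suffix w \<le> v})"
        using IH[of b v] ab 1 by (simp add: n_def S_def)
      show "?P a \<in> span {?P a}"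
        by (simp add: span_base)
      fix y x assume "x \<in> ?P ` {w \<in> lyndon_words A (length b + length v). std_suffix w \<le> v}"
        and "y \<in> {?P a}"
      then obtain w where w: "w \<in> {w \<in> lyndon_words A (length b + length v). std_suffix w \<le> v}"
        and xy: "x = ?P w" "y = ?P a" by blast
      moreover have "w < v"
        using w_below[OF w] pos by simp
      ultimately show "lie_bracket y x \<in> span (?P ` {w \<in> lyndon_words A n. std_suffix w \<le> v})"
        using below[of a w] ab by (simp add: S_def lyndon_words_def n_def)
    qed
    moreover have "?P u = lie_bracket (?P a) (?P b)"
      using lyndon_bracket_factors[OF len] by (simp add: a_def b_def)
    ultimately show ?thesis
      using lie_bracket_leibniz[of "?P a" "?P b" "?P v"] by (simp add: S_def span_add)
  qed
  then show ?case
    by (simp add: S_def n_def)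
qed

lemma magma_eval_in_span_lyndon:
  fixes g :: "'b::linorder \<Rightarrow> 'c::lie_algebra"
  assumes "finite A" "set_free_magma t \<subseteq> A"
  shows "magma_eval g lie_bracket t \<in> span (lyndon_bracket g ` lyndon_words A (magma_degree t))"
  using assms(2)
proof (induction t)
  case (Gen a)
  then have "[a] \<in> lyndon_words A 1"
    by (simp add: lyndon_words_def lyndon_singleton)
  then have "lyndon_bracket g [a] \<in> span (lyndon_bracket g ` lyndon_words A 1)"
    by (intro span_base imageI)
  then show ?case
    by (simp add: lyndon_bracket_singleton)
next
  case (Prd s t)
  let ?P = "lyndon_bracket g"
  let ?n = "magma_degree s + magma_degree t"
  have less: "lie_bracket (?P u) (?P v) \<in> span (?P ` lyndon_words A ?n)"
    if "lyndon u" "lyndon v" "set u \<subseteq> A" "set v \<subseteq> A" "u < v" "length u + length v = ?n" for u v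
    using lie_bracket_lyndon_less[OF assms(1) that(1-5), of g] that(6)
      span_mono[of "?P ` {w \<in> lyndon_words A ?n. std_suffix w \<le> v}" "?P ` lyndon_words A ?n"]
    by auto
  have "lie_bracket (magma_eval g lie_bracket s) (magma_eval g lie_bracket t)
      \<in> span (?P ` lyndon_words A ?n)"
  proof (rule lie_bracket_span)
    show "magma_eval g lie_bracket s \<in> span (?P ` lyndon_words A (magma_degree s))"
      "magma_eval g lie_bracket t \<in> span (?P ` lyndon_words A (magma_degree t))"
      using Prd by auto
    fix x y assume "x \<in> ?P ` lyndon_words A (magma_degree s)"
      "y \<in> ?P ` lyndon_words A (magma_degree t)"
    then obtain u v where uv: "x = ?P u" "y = ?P v" "u \<in> lyndon_words A (magma_degree s)"
      "v \<in> lyndon_words A (magma_degree t)" by blast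
    consider "u < v" | "u = v" | "v < u" by fastforce
    then show "lie_bracket x y \<in> span (?P ` lyndon_words A ?n)"
    proof cases
      case 1
      then show ?thesis
        using less[of u v] uv by (simp add: lyndon_words_def)
    next
      case 2
      then show ?thesis
        using uv by (simp add: lie_bracket_self span_zero)
    next
      case 3
      then have "- lie_bracket (?P v) (?P u) \<in> span (?P ` lyndon_words A ?n)"
        using less[of v u] uv by (intro span_neg) (simp add: lyndon_words_def)
      then show ?thesis
        using uv lie_bracket_antisym[of x y] by simp
    qed
  qed
  then show ?case by simp
qed


section \<open>Independence in the free associative algebra\<close>

text \<open>With concatenation as addition of lists, the finitely supported functions
  \<open>'b list \<Rightarrow>\<^sub>0 real\<close> with the convolution product are the free associative algebra over \<open>'b\<close>.
  The commutator turns it into a Lie algebra.\<close>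

instantiation list :: (type) monoid_add
begin

definition zero_list_def: "0 = ([] :: 'a list)"

definition plus_list_def: "xs + ys = xs @ (ys :: 'a list)"

instance
  by standard (simp_all add: zero_list_def plus_list_def)

end

lemma lookup_scaleR: "Poly_Mapping.lookup (c *\<^sub>R p) t = c *\<^sub>R Poly_Mapping.lookup p t"
  for p :: "'a \<Rightarrow>\<^sub>0 'b::real_vector"
proof -
  have "finite {i. c *\<^sub>R Poly_Mapping.lookup p i \<noteq> 0}"
    by (rule finite_subset[of _ "Poly_Mapping.keys p"]) (auto simp: in_keys_iff)
  then show ?thesis
    by (simp add: scaleR_poly_mapping_def)
qed

lemma lookup_mult_keys:
  fixes p q :: "'a::monoid_add \<Rightarrow>\<^sub>0 'b::semiring_0"
  assumes "finite S" "Poly_Mapping.keys p \<subseteq> S" "finite T" "Poly_Mapping.keys q \<subseteq> T"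
  shows "Poly_Mapping.lookup (p * q) k = (\<Sum>a\<in>S. \<Sum>b\<in>T.
    (if k = a + b then Poly_Mapping.lookup p a * Poly_Mapping.lookup q b else 0))"
proof -
  have inner: "Sum_any (\<lambda>b. Poly_Mapping.lookup q b when k = a + b)
      = (\<Sum>b\<in>T. Poly_Mapping.lookup q b when k = a + b)" for a
    using assms(3,4) by (intro Sum_any.expand_superset) (auto simp: in_keys_iff)
  have "Poly_Mapping.lookup (p * q) k = (\<Sum>a\<in>S. Poly_Mapping.lookup p a *
      (\<Sum>b\<in>T. Poly_Mapping.lookup q b when k = a + b))"
    unfolding lookup_mult inner
    using assms(1,2) by (intro Sum_any.expand_superset) (auto simp: in_keys_iff dest!: mult_not_zero)
  then show ?thesis
    by (auto simp: sum_distrib_left when_def intro!: sum.cong)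
qed

lemma poly_mapping_scaleR_mult:
  fixes p q :: "'a::monoid_add \<Rightarrow>\<^sub>0 'b::real_algebra"
  shows "(c *\<^sub>R p) * q = c *\<^sub>R (p * q)" "p * (c *\<^sub>R q) = c *\<^sub>R (p * q)"
proof -
  have keys: "Poly_Mapping.keys (c *\<^sub>R r) \<subseteq> Poly_Mapping.keys r" for r :: "'a \<Rightarrow>\<^sub>0 'b"
    by (auto simp: in_keys_iff lookup_scaleR)
  note lk = lookup_mult_keys[of "Poly_Mapping.keys p" _ "Poly_Mapping.keys q", OF finite_keys _ finite_keys]
  show "(c *\<^sub>R p) * q = c *\<^sub>R (p * q)"
    by (rule poly_mapping_eqI)
      (auto simp: lookup_scaleR lk[OF keys order.refl] lk[OF order.refl order.refl]
        scaleR_sum_right intro!: sum.cong)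
  show "p * (c *\<^sub>R q) = c *\<^sub>R (p * q)"
    by (rule poly_mapping_eqI)
      (auto simp: lookup_scaleR lk[OF order.refl keys] lk[OF order.refl order.refl]
        scaleR_sum_right intro!: sum.cong)
qed

instantiation poly_mapping :: (monoid_add, real_algebra) lie_algebra
begin

definition lie_bracket_poly_mapping_def: "lie_bracket p q = p * q - q * (p :: 'a \<Rightarrow>\<^sub>0 'b)"

instance
  by standard (simp_all add: lie_bracket_poly_mapping_def poly_mapping_scaleR_mult
      scaleR_diff_right algebra_simps)

end

text \<open>The word \<open>w\<close> occurs in \<open>p\<close> with coefficient \<open>1\<close>, and all other words of \<open>p\<close> have the same
  length and are lexicographically larger.\<close>

definition leading_word :: "'b::linorder list \<Rightarrow> ('b list \<Rightarrow>\<^sub>0 real) \<Rightarrow> bool" where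
  "leading_word w p \<longleftrightarrow>
     Poly_Mapping.keys (p - Poly_Mapping.single w 1) \<subseteq> {x. length x = length w \<and> w < x}"

lemma leading_word_lookup:
  assumes "leading_word w p"
  shows "Poly_Mapping.lookup p w = 1"
    and "Poly_Mapping.lookup p x \<noteq> 0 \<Longrightarrow> length x = length w \<and> w \<le> x"
proof -
  have "w \<notin> Poly_Mapping.keys (p - Poly_Mapping.single w 1)"
    using assms by (auto simp: leading_word_def)
  then show "Poly_Mapping.lookup p w = 1"
    by (simp add: in_keys_iff lookup_minus)
  assume x: "Poly_Mapping.lookup p x \<noteq> 0"
  show "length x = length w \<and> w \<le> x"
  proof (cases "x = w")
    case False
    then have "x \<in> Poly_Mapping.keys (p - Poly_Mapping.single w 1)"
      using x by (simp add: in_keys_iff lookup_minus lookup_single when_def)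
    then show ?thesis
      using assms by (auto simp: leading_word_def)
  qed simp
qed

lemma lex_append_le_mono:
  fixes u v x y :: "'b::linorder list"
  assumes "length x = length u" "u \<le> x" "v \<le> y"
  shows "u @ v \<le> x @ y"
proof (cases "u = x")
  case True
  then show ?thesis
    using assms(3) lex_append_cancel[of u v y] by (cases "v = y") auto
next
  case False
  then have "u @ v < x @ y"
    using assms(1,2) by (intro lex_append_mono) auto
  then show ?thesis by simp
qed

lemma leading_word_bracket:
  assumes p: "leading_word u p" and q: "leading_word v q" and less: "u @ v < v @ u"
  shows "leading_word (u @ v) (lie_bracket p q)"
proof -
  let ?lk = "Poly_Mapping.lookup"
  have keysD: "\<exists>a b. x = a @ b \<and> ?lk r a \<noteq> 0 \<and> ?lk s b \<noteq> 0"
    if "?lk (r * s) x \<noteq> 0" for r s :: "'a list \<Rightarrow>\<^sub>0 real" and x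
  proof -
    have "x \<in> Poly_Mapping.keys (r * s)"
      using that by (simp add: in_keys_iff)
    then have "x \<in> {a + b | a b. a \<in> Poly_Mapping.keys r \<and> b \<in> Poly_Mapping.keys s}"
      using keys_mult by blast
    then show ?thesis
      by (auto simp: in_keys_iff plus_list_def)
  qed
  define r s where "r = p - Poly_Mapping.single u 1" and "s = q - Poly_Mapping.single v 1"
  have r: "length x = length u \<and> u < x" if "?lk r x \<noteq> 0" for x
    using p that by (auto simp: leading_word_def r_def in_keys_iff)
  have s: "length x = length v \<and> v < x" if "?lk s x \<noteq> 0" for x
    using q that by (auto simp: leading_word_def s_def in_keys_iff)
  have "Poly_Mapping.single u 1 * Poly_Mapping.single v 1 = Poly_Mapping.single (u @ v) (1::real)"
    by (simp add: mult_single plus_list_def)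
  then have eq: "lie_bracket p q - Poly_Mapping.single (u @ v) 1
      = r * q + Poly_Mapping.single u 1 * s - q * p"
    by (simp add: lie_bracket_poly_mapping_def r_def s_def algebra_simps)
  have "length x = length (u @ v) \<and> u @ v < x"
    if "?lk (r * q + Poly_Mapping.single u 1 * s - q * p) x \<noteq> 0" for x
  proof -
    consider "?lk (r * q) x \<noteq> 0" | "?lk (Poly_Mapping.single u 1 * s) x \<noteq> 0" | "?lk (q * p) x \<noteq> 0"
      using \<open>?lk (r * q + Poly_Mapping.single u 1 * s - q * p) x \<noteq> 0\<close>
      by (fastforce simp: lookup_add lookup_minus)
    then show ?thesis
    proof cases
      case 1
      then obtain a b where ab: "x = a @ b" "?lk r a \<noteq> 0" "?lk q b \<noteq> 0"
        using keysD by blast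
      then show ?thesis
        using r[OF ab(2)] leading_word_lookup(2)[OF q ab(3)] lex_append_mono[of u a v b] by auto
    next
      case 2
      then obtain b where ab: "x = u @ b" "?lk s b \<noteq> 0"
        using keysD[OF 2] by (auto simp: lookup_single when_def split: if_splits)
      then show ?thesis
        using s[OF ab(2)] by (simp add: lex_append_cancel)
    next
      case 3
      then obtain b a where ab: "x = b @ a" "?lk q b \<noteq> 0" "?lk p a \<noteq> 0"
        using keysD by blast
      then show ?thesis
        using leading_word_lookup(2)[OF q ab(2)] leading_word_lookup(2)[OF p ab(3)] less
          lex_append_le_mono[of b v u a] by auto
    qed
  qed
  then show ?thesis
    by (auto simp: leading_word_def eq in_keys_iff)
qed

text \<open>If \<open>w = u @ v\<close> is the standard factorization of a Lyndon word, then \<open>u @ v < v \<le> v @ u\<close>,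
  so the leading word \<open>u @ v\<close> of the first product in the commutator is not touched by the
  second.\<close>

lemma leading_word_lyndon_bracket:
  assumes "lyndon w" "\<And>a. a \<in> set w \<Longrightarrow> g a = Poly_Mapping.single [a] (1::real)"
  shows "leading_word w (lyndon_bracket g w)"
  using assms
proof (induction "length w" arbitrary: w rule: less_induct)
  case less
  show ?case
  proof (cases "1 < length w")
    case True
    note std = std_factorization[OF True]
    have "w < std_suffix w @ std_prefix w"
      using std_suffix_greater[OF less.prems(1) True]
        lex_append_le[of "std_suffix w" "std_prefix w"] by simp
    then have "leading_word (std_prefix w @ std_suffix w) (lyndon_bracket g w)"
      unfolding lyndon_bracket_factors[OF True]
      using less.hyps[OF length_std_factors(2)[OF True] lyndon_std_prefix[OF less.prems(1) True]]
        less.hyps[OF length_std_factors(3)[OF True] lyndon_std_suffix[OF True]]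
        set_std_factors[OF True] less.prems(2)
      by (intro leading_word_bracket) (auto simp: std(1))
    then show ?thesis
      by (simp add: std(1))
  next
    case False
    then obtain a where "w = [a]"
      using lyndon_not_Nil[OF less.prems(1)] by (cases w) auto
    then show ?thesis
      using less.prems(2) by (simp add: lyndon_bracket_singleton leading_word_def)
  qed
qed

lemma leading_word_unique:
  assumes "leading_word w p" "leading_word w' p"
  shows "w = w'"
proof (rule antisym)
  show "w \<le> w'"
    using leading_word_lookup(2)[OF assms(1), of w'] leading_word_lookup(1)[OF assms(2)] by simp
  show "w' \<le> w"
    using leading_word_lookup(2)[OF assms(2), of w] leading_word_lookup(1)[OF assms(1)] by simp
qed

lemma leading_words_independent:
  assumes "finite W" "\<And>w. w \<in> W \<Longrightarrow> leading_word w (f w)"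
    and "(\<Sum>w\<in>W. c w *\<^sub>R f w) = 0" "w \<in> W"
  shows "c w = 0"
proof (rule ccontr)
  assume "c w \<noteq> 0"
  define m where "m = Min {w \<in> W. c w \<noteq> 0}"
  have "m \<in> {w \<in> W. c w \<noteq> 0}"
    unfolding m_def using assms(1,4) \<open>c w \<noteq> 0\<close> by (intro Min_in) auto
  then have m: "m \<in> W" "c m \<noteq> 0" by auto
  have min: "m \<le> x" if "x \<in> W" "c x \<noteq> 0" for x
    unfolding m_def using assms(1) that by (intro Min_le) auto
  have zero: "c x * Poly_Mapping.lookup (f x) m = 0" if "x \<in> W - {m}" for x
    using min[of x] leading_word_lookup(2)[OF assms(2)[of x], of m] that by force
  have "(\<Sum>x\<in>W. c x * Poly_Mapping.lookup (f x) m) = c m * Poly_Mapping.lookup (f m) m"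
    using sum.remove[OF assms(1) m(1), of "\<lambda>x. c x * Poly_Mapping.lookup (f x) m"]
      sum.neutral[of "W - {m}" "\<lambda>x. c x * Poly_Mapping.lookup (f x) m"] zero by simp
  also have "\<dots> = c m"
    using leading_word_lookup(1)[OF assms(2)[OF m(1)]] by simp
  also have "(\<Sum>x\<in>W. c x * Poly_Mapping.lookup (f x) m)
      = Poly_Mapping.lookup (\<Sum>w\<in>W. c w *\<^sub>R f w) m"
    by (simp add: lookup_sum lookup_scaleR_pm)
  also have "\<dots> = 0"
    using assms(3) by simp
  finally show False
    using m(2) by simp
qed


section \<open>The dimension of the truncated free Lie algebra\<close>

lemma finite_lyndon_words: "finite A \<Longrightarrow> finite (lyndon_words A n)"
  by (rule finite_subset[OF _ finite_lists_length_eq[of A n]]) (auto simp: lyndon_words_def)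

lemma lie_hom_magma_eval:
  "lie_hom h \<Longrightarrow> h (magma_eval g lie_bracket t) = magma_eval (\<lambda>a. h (g a)) lie_bracket t"
  by (induction t) (simp_all add: lie_hom_def)

lemma magma_eval_map: "magma_eval g m (map_free_magma e t) = magma_eval (\<lambda>a. g (e a)) m t"
  by (induction t) simp_all

lemma magma_degree_map: "magma_degree (map_free_magma e t) = magma_degree t"
  by (induction t) simp_all

text \<open>The Lyndon brackets of length at most \<open>N\<close> form a basis of the truncation. The letters are
  taken from a linearly ordered type \<open>'b\<close> because the generators themselves carry no order.\<close>

lemma free_lie_trunc_dim_eq:
  fixes e :: "'b::linorder \<Rightarrow> 'a::finite"
  assumes e: "bij_betw e A UNIV"
  shows "free_lie_trunc_dim TYPE('a) N = (\<Sum>n = 1..N. card (lyndon_words A n))"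
proof -
  define g :: "'b \<Rightarrow> 'a free_lie" where "g = (\<lambda>b. lie_gen (e b))"
  define P where "P = lyndon_bracket g"
  define W where "W = (\<Union>n\<in>{1..N}. lyndon_words A n)"
  define e' where "e' = the_inv_into A e"
  have e': "e (e' a) = a" "e' a \<in> A" "b \<in> A \<Longrightarrow> e' (e b) = b" for a b
    using e by (auto simp: e'_def bij_betw_def f_the_inv_into_f the_inv_into_into the_inv_into_f_f)
  have finA: "finite A"
    using bij_betw_finite[OF e] by simp
  have finW: "finite W"
    using finA by (auto simp: W_def finite_lyndon_words)
  define h :: "'a free_lie \<Rightarrow> ('b list \<Rightarrow>\<^sub>0 real)"
    where "h = free_lie_extend (\<lambda>a. Poly_Mapping.single [e' a] 1)"
  have hom: "lie_hom h"
    unfolding h_def by (rule lie_hom_free_lie_extend)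
  then have lin: "linear h"
    by (simp add: lie_hom_def)
  have lead: "leading_word w (h (P w))" if "w \<in> W" for w
  proof -
    have "h (P w) = lyndon_bracket (\<lambda>b. h (g b)) w"
      by (simp add: P_def lyndon_bracket_def lie_hom_magma_eval[OF hom])
    then show ?thesis
      using that leading_word_lyndon_bracket[of w "\<lambda>b. h (g b)"]
      by (force simp: W_def lyndon_words_def g_def h_def free_lie_extend_gen e'(3))
  qed
  have inj: "inj_on P W"
    by (rule inj_onI) (metis lead leading_word_unique)
  have "dim (free_lie_trunc N :: 'a free_lie set) = card W"
  proof (rule dim_unique)
    show "card (P ` W) = card W"
      by (rule card_image[OF inj])
    show "independent (P ` W)"
    proof (rule independent_if_scalars_zero)
      show "finite (P ` W)"
        using finW by simp
      fix c x assume sum: "(\<Sum>x\<in>P ` W. c x *\<^sub>R x) = 0" and "x \<in> P ` W"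
      then obtain w where w: "w \<in> W" "x = P w" by blast
      have "(\<Sum>w\<in>W. c (P w) *\<^sub>R h (P w)) = h (\<Sum>x\<in>P ` W. c x *\<^sub>R x)"
        by (simp add: sum.reindex[OF inj] linear_sum[OF lin] linear_scale[OF lin])
      also have "\<dots> = 0"
        using sum by (simp add: linear_0[OF lin])
      finally show "c x = 0"
        using leading_words_independent[OF finW lead, of "\<lambda>w. c (P w)" w] w by simp
    qed
    show "P ` W \<subseteq> free_lie_trunc N"
    proof
      fix x assume "x \<in> P ` W"
      then obtain w n where w: "x = P w" "n \<in> {1..N}" "w \<in> lyndon_words A n"
        by (auto simp: W_def)
      have "P w = lie_monomial (map_free_magma e (lyndon_tree w))"
        by (simp add: P_def g_def lyndon_bracket_def lie_monomial_def magma_eval_map)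
      moreover have "magma_degree (map_free_magma e (lyndon_tree w)) = n"
        using w by (simp add: magma_degree_map magma_degree_lyndon_tree lyndon_words_def
            lyndon_not_Nil)
      ultimately have "x \<in> free_lie_component n"
        unfolding free_lie_component_def w(1) by (intro span_base) blast
      then have "\<forall>k\<in>{1..N}. (if k = n then x else 0) \<in> free_lie_component k"
        by (simp add: free_lie_component_def span_zero)
      moreover have "x = (\<Sum>k = 1..N. if k = n then x else 0)"
        using w(2) by simp
      ultimately show "x \<in> free_lie_trunc N"
        unfolding free_lie_trunc_def by blast
    qed
    show "(free_lie_trunc N :: 'a free_lie set) \<subseteq> span (P ` W)"
    proof
      fix z :: "'a free_lie" assume "z \<in> free_lie_trunc N"
      then obtain x where x: "z = (\<Sum>n = 1..N. x n)" "\<And>n. n \<in> {1..N} \<Longrightarrow> x n \<in> free_lie_component n"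
        unfolding free_lie_trunc_def by blast
      have "free_lie_component n \<subseteq> span (P ` W)" if n: "n \<in> {1..N}" for n
        unfolding free_lie_component_def
      proof (rule span_minimal)
        show "lie_monomial ` {t. magma_degree t = n} \<subseteq> span (P ` W)"
        proof
          fix y :: "'a free_lie" assume "y \<in> lie_monomial ` {t. magma_degree t = n}"
          then obtain t where t: "y = lie_monomial t" "magma_degree t = n" by blast
          let ?t = "map_free_magma e' t"
          have "y = magma_eval g lie_bracket ?t"
            by (simp add: t(1) lie_monomial_def magma_eval_map g_def e'(1))
          moreover have "set_free_magma ?t \<subseteq> A"
            using e'(2) by (auto simp: free_magma.set_map)
          ultimately have "y \<in> span (P ` lyndon_words A n)"
            using magma_eval_in_span_lyndon[OF finA, of ?t g] t(2)
            by (simp add: magma_degree_map P_def)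
          moreover have "span (P ` lyndon_words A n) \<subseteq> span (P ` W)"
            unfolding W_def using n by (intro span_mono image_mono) blast
          ultimately show "y \<in> span (P ` W)" by blast
        qed
      qed (rule subspace_span)
      then show "z \<in> span (P ` W)"
        unfolding x(1) using x(2) by (intro span_sum) blast
    qed
  qed
  also have "card W = (\<Sum>n = 1..N. card (lyndon_words A n))"
    unfolding W_def
  proof (rule card_UN_disjoint)
    show "\<forall>n\<in>{1..N}. finite (lyndon_words A n)"
      by (simp add: finite_lyndon_words[OF finA])
  qed (auto simp: lyndon_words_def)
  finally show ?thesis
    by (simp add: free_lie_trunc_dim_def)
qed


section \<open>Counting Lyndon words\<close>

lemma lyndon_less_rotate:
  assumes "lyndon w" "0 < k" "k < length w"
  shows "w < rotate k w"
proof -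
  have "w < drop k w"
    using lyndonD[of "take k w" "drop k w"] lyndon_not_Nil[OF assms(1)] assms by simp
  also have "\<dots> \<le> drop k w @ take k w"
    by (rule lex_append_le)
  finally show ?thesis
    using assms(3) by (simp add: rotate_drop_take)
qed

text \<open>Together with \<open>lyndon_less_rotate\<close>: the Lyndon words are the words that are strictly
  smaller than all their nontrivial rotations.\<close>

lemma lyndon_if_less_rotations:
  assumes "w \<noteq> []" "\<And>k. 0 < k \<Longrightarrow> k < length w \<Longrightarrow> w < rotate k w"
  shows "lyndon w"
  unfolding lyndon_def
proof (intro conjI allI impI)
  fix u v assume w: "w = u @ v" and ne: "u \<noteq> []" "v \<noteq> []"
  have rot_u: "w < v @ u"
    using assms(2)[of "length u"] w ne by (simp add: rotate_append)
  show "w < v"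
  proof (rule ccontr)
    assume "\<not> w < v"
    moreover have "v \<noteq> w"
      using w ne by simp
    ultimately have "v < w" by simp
    then show False
    proof (cases rule: lex_less_cases)
      case (1 t)
      then have "t \<noteq> []" "length t = length u"
        using w ne by (auto dest: arg_cong[of _ _ length])
      have "t < u"
        using rot_u 1 by (simp add: lex_append_cancel)
      moreover have "w < t @ v"
        using assms(2)[of "length v"] 1 \<open>t \<noteq> []\<close> ne by (simp add: rotate_append)
      then have "\<not> t < u"
        using lex_append_mono[of t u v v] w \<open>length t = length u\<close> by auto
      ultimately show False by simp
    next
      case 2
      from 2[of u "[]"] show False
        using rot_u by simp
    qed
  qed
qed (use assms in simp)

lemma rotate_lyndon_inject:
  assumes "lyndon w" "lyndon w'" "length w = n" "length w' = n" "k \<le> j" "j < n"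
    and "rotate k w = rotate j w'"
  shows "k = j \<and> w = w'"
proof -
  have "w = rotate (n - k) (rotate k w)"
    unfolding rotate_rotate using assms by simp
  also have "\<dots> = rotate (n - k + j) w'"
    unfolding assms(7) rotate_rotate ..
  also have "n - k + j = (j - k) + n"
    using assms by simp
  also have "rotate \<dots> w' = rotate (j - k) (rotate n w')"
    by (simp only: rotate_rotate)
  also have "rotate n w' = w'"
    using assms(4) by simp
  finally have w: "w = rotate (j - k) w'" .
  show ?thesis
  proof (cases "j = k")
    case True
    then show ?thesis
      using w by simp
  next
    case False
    then have "w' < w"
      using w lyndon_less_rotate[OF assms(2), of "j - k"] assms by simp
    moreover have "w' = rotate (n - (j - k)) w"
      using w assms by (simp add: rotate_rotate)
    then have "w < w'"
      using lyndon_less_rotate[OF assms(1), of "n - (j - k)"] assms False by simp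
    ultimately show ?thesis by simp
  qed
qed

text \<open>A Lyndon word of length \<open>n\<close> has \<open>n\<close> distinct rotations, and different Lyndon words have no
  rotation in common.\<close>

lemma card_lyndon_words_upper:
  assumes "finite A"
  shows "n * card (lyndon_words A n) \<le> card A ^ n"
proof -
  let ?R = "\<lambda>(k, w). rotate k w"
  have "inj_on ?R ({..<n} \<times> lyndon_words A n)"
  proof (rule inj_onI, clarsimp)
    fix k w j w'
    assume "k < n" "j < n" "w \<in> lyndon_words A n" "w' \<in> lyndon_words A n"
      "rotate k w = rotate j w'"
    then show "k = j \<and> w = w'"
      using rotate_lyndon_inject[of w w' n k j] rotate_lyndon_inject[of w' w n j k]
      by (cases "k \<le> j") (auto simp: lyndon_words_def)
  qed
  then have "card (?R ` ({..<n} \<times> lyndon_words A n)) = n * card (lyndon_words A n)"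
    by (simp add: card_image card_cartesian_product)
  moreover have "card (?R ` ({..<n} \<times> lyndon_words A n)) \<le> card {w. set w \<subseteq> A \<and> length w = n}"
    using assms by (intro card_mono finite_lists_length_eq) (auto simp: lyndon_words_def)
  ultimately show ?thesis
    using card_lists_length_eq[OF assms] by simp
qed

text \<open>A word fixed by a nontrivial rotation is a proper power: its two factors commute.\<close>

lemma periodic_word:
  assumes "rotate k w = w" "0 < k" "k < length w"
  obtains z where "w = concat (replicate (length w div length z) z)" "2 * length z \<le> length w"
    "set z \<subseteq> set w"
proof -
  have "drop k w @ take k w = take k w @ drop k w"
    using assms by (simp add: rotate_drop_take)
  then obtain p q z where pq: "concat (replicate p z) = drop k w" "concat (replicate q z) = take k w"
    using comm_append_are_replicate by blast
  then have w: "w = concat (replicate (q + p) z)"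
    by (metis append_take_drop_id concat_append replicate_add)
  have "p \<noteq> 0" "q \<noteq> 0" "z \<noteq> []"
    using pq assms by (auto intro!: Nat.gr0I)
  have len: "length w = (q + p) * length z"
    by (subst w) (simp add: length_concat sum_list_replicate)
  show thesis
  proof
    show "w = concat (replicate (length w div length z) z)"
      using w len \<open>z \<noteq> []\<close> by simp
    show "2 * length z \<le> length w"
      unfolding len using \<open>p \<noteq> 0\<close> \<open>q \<noteq> 0\<close> by (intro mult_right_mono) auto
    show "set z \<subseteq> set w"
      using \<open>q \<noteq> 0\<close> by (subst w) auto
  qed
qed

text \<open>A word that is not fixed by any nontrivial rotation is a rotation of a Lyndon word, namely
  of its smallest rotation. The other words are proper powers, hence determined by their length
  and by a root of length at most \<open>n div 2\<close>.\<close>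

lemma card_lyndon_words_lower:
  fixes A :: "'b::linorder set"
  assumes "finite A" "0 < n"
  shows "card A ^ n \<le> n * card (lyndon_words A n) + (\<Sum>i\<le>n div 2. card A ^ i)"
proof -
  let ?R = "\<lambda>(k, w). rotate k w"
  let ?X = "{..<n} \<times> lyndon_words A n"
  let ?Z = "{z. set z \<subseteq> A \<and> length z \<le> n div 2}"
  let ?pow = "\<lambda>z. concat (replicate (n div length z) z)"
  have "w \<in> ?R ` ?X \<union> ?pow ` ?Z" if w: "set w \<subseteq> A" "length w = n" for w
  proof (cases "\<exists>k. 0 < k \<and> k < n \<and> rotate k w = w")
    case True
    then obtain z where "w = ?pow z" "2 * length z \<le> n" "set z \<subseteq> set w"
      using periodic_word[of _ w] w(2) by metis
    then have "w = ?pow z" "z \<in> ?Z"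
      using w(1) by auto
    then show ?thesis by blast
  next
    case False
    define m where "m = Min ((\<lambda>k. rotate k w) ` {..<n})"
    have "m \<in> (\<lambda>k. rotate k w) ` {..<n}"
      unfolding m_def using assms(2) by (intro Min_in) auto
    then obtain k where k: "k < n" "m = rotate k w" by blast
    have le: "m \<le> rotate i w" for i
    proof -
      have "rotate i w = rotate (i mod n) w"
        using rotate_conv_mod[of i w] w(2) by simp
      then show ?thesis
        unfolding m_def using assms(2) by (intro Min_le) auto
    qed
    have len: "length m = n"
      using k w by simp
    have w_rot: "w = rotate (n - k) m"
      using k w by (simp add: rotate_rotate)
    have "lyndon m"
    proof (rule lyndon_if_less_rotations)
      show "m \<noteq> []"
        using len assms(2) by auto
      fix i assume i: "0 < i" "i < length m"
      have "rotate i w \<noteq> w"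
        using False i len by auto
      moreover have "rotate i w = rotate (n - k) (rotate i m)"
        by (simp add: w_rot rotate_rotate add.commute)
      ultimately have "rotate i m \<noteq> m"
        using w_rot by auto
      then show "m < rotate i m"
        using le[of "i + k"] k(2) by (simp add: rotate_rotate)
    qed
    then have "m \<in> lyndon_words A n"
      using w(1) k(2) len by (simp add: lyndon_words_def)
    moreover have "w = rotate ((n - k) mod n) m"
      using w_rot rotate_conv_mod[of "n - k" m] len by simp
    moreover have "(n - k) mod n < n"
      using assms(2) by simp
    ultimately have "w \<in> ?R ` ?X" by force
    then show ?thesis by blast
  qed
  then have "{w. set w \<subseteq> A \<and> length w = n} \<subseteq> ?R ` ?X \<union> ?pow ` ?Z"
    by blast
  moreover have fin: "finite ?X" "finite ?Z"
    using assms(1) by (auto simp: finite_lyndon_words finite_lists_length_le)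
  ultimately have "card {w. set w \<subseteq> A \<and> length w = n} \<le> card (?R ` ?X \<union> ?pow ` ?Z)"
    by (intro card_mono) auto
  also have "\<dots> \<le> card (?R ` ?X) + card (?pow ` ?Z)"
    by (rule card_Un_le)
  also have "\<dots> \<le> card ?X + card ?Z"
    using fin by (intro add_mono card_image_le)
  finally show ?thesis
    using assms(1)
    by (simp add: card_lists_length_eq card_lists_length_le card_cartesian_product)
qed


section \<open>Asymptotics of the partial sums\<close>

lemma lyndon_words_asymp:
  assumes "finite A" "card A = d" "d \<ge> 2"
  shows "(\<lambda>n. real n * real (card (lyndon_words A n)) / real d ^ n) \<longlonglongrightarrow> 1"
proof (rule tendsto_sandwich)
  let ?l = "\<lambda>n. card (lyndon_words A n)"
  let ?x = "1 / real d"
  show "\<forall>\<^sub>F n in sequentially. real n * real (?l n) / real d ^ n \<le> 1"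
  proof (rule always_eventually, rule allI)
    fix n
    have "real (n * ?l n) \<le> real (d ^ n)"
      using card_lyndon_words_upper[OF assms(1), of n] assms(2) by (simp only: of_nat_le_iff)
    then show "real n * real (?l n) / real d ^ n \<le> 1"
      using assms(3) by (simp add: divide_le_eq)
  qed
  show "\<forall>\<^sub>F n in sequentially. 1 - real d * ?x ^ (n div 2) \<le> real n * real (?l n) / real d ^ n"
  proof (rule eventually_mono[OF eventually_gt_at_top[of 0]])
    fix n :: nat assume n: "0 < n"
    \<comment> \<open>A crude bound on the geometric sum, valid because \<open>d \<ge> 2\<close>.\<close>
    have geo: "(\<Sum>i\<le>m. d ^ i) \<le> d ^ Suc m" for m
    proof (induction m)
      case (Suc m)
      then have "(\<Sum>i\<le>Suc m. d ^ i) \<le> 2 * d ^ Suc m" by simp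
      also have "\<dots> \<le> d ^ Suc (Suc m)"
        using assms(3) by simp
      finally show ?case .
    qed (use assms(3) in simp)
    have "d ^ n \<le> n * ?l n + d ^ Suc (n div 2)"
      using card_lyndon_words_lower[OF assms(1) n] geo[of "n div 2"] assms(2) by simp
    then have "real (d ^ n) \<le> real (n * ?l n + d ^ Suc (n div 2))"
      by (simp only: of_nat_le_iff)
    then have *: "real d ^ n \<le> real n * real (?l n) + real d * real d ^ (n div 2)"
      by simp
    have "real d ^ (n div 2) * real d ^ (n div 2) \<le> real d ^ n"
      unfolding power_add[symmetric] using assms(3) by (intro power_increasing) auto
    then have "real d ^ (n div 2) / real d ^ n \<le> ?x ^ (n div 2)"
      using assms(3) by (simp add: field_simps)
    then have "real d * (real d ^ (n div 2) / real d ^ n) \<le> real d * ?x ^ (n div 2)"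
      by (rule mult_left_mono) simp
    moreover have "1 \<le> real n * real (?l n) / real d ^ n + real d * (real d ^ (n div 2) / real d ^ n)"
      using divide_right_mono[OF *, of "real d ^ n"] assms(3) by (simp add: add_divide_distrib)
    ultimately show "1 - real d * ?x ^ (n div 2) \<le> real n * real (?l n) / real d ^ n"
      by linarith
  qed
  have "filterlim (\<lambda>n::nat. n div 2) at_top sequentially"
    unfolding filterlim_at_top
    by (metis (mono_tags, lifting) eventually_sequentially div_le_mono nonzero_mult_div_cancel_left
        zero_neq_numeral)
  moreover have "(\<lambda>n. ?x ^ n) \<longlonglongrightarrow> 0"
    using assms(3) by (intro LIMSEQ_power_zero) simp
  ultimately have "(\<lambda>n. ?x ^ (n div 2)) \<longlonglongrightarrow> 0"
    by (rule filterlim_compose[rotated])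
  then show "(\<lambda>n. 1 - real d * ?x ^ (n div 2)) \<longlonglongrightarrow> 1"
    by (auto intro!: tendsto_eq_intros)
qed simp

text \<open>Reversing the order of summation, \<open>N / x ^ N * (\<Sum>n = 1..N. f n)\<close> is a sum over \<open>k < N\<close>
  whose \<open>k\<close>-th term tends to \<open>(1 / x) ^ k\<close> as \<open>N\<close> grows. Since \<open>N / (N - k) \<le> k + 1\<close> for
  \<open>k < N\<close>, the terms are dominated by a constant times \<open>(k + 1) * (1 / x) ^ k\<close>, and dominated
  convergence for series gives the limit \<open>x / (x - 1)\<close>.\<close>

lemma sum_asymp_equiv_power_over_index:
  fixes f :: "nat \<Rightarrow> real" and x :: real
  assumes x: "x > 1" and lim: "(\<lambda>n. real n * f n / x ^ n) \<longlonglongrightarrow> 1"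
  shows "(\<lambda>N. \<Sum>n = 1..N. f n) \<sim>[sequentially] (\<lambda>N. x ^ (N + 1) / ((x - 1) * real N))"
proof -
  define r where "r n = real n * f n / x ^ n" for n
  have r: "r \<longlonglongrightarrow> 1"
    using lim unfolding r_def .
  obtain B where B: "B > 0" "\<And>n. norm (r n) \<le> B"
    using convergent_imp_Bseq[OF convergentI[OF r]] by (auto simp: Bseq_def)
  \<comment> \<open>Extended by \<open>0\<close> for \<open>k \<ge> N\<close>, so that the finite sums become series.\<close>
  define a where "a k N = (if k < N then r (N - k) * (real N / real (N - k)) / x ^ k else 0)" for k N
  have "(\<lambda>N. suminf (\<lambda>k. a k N)) \<longlonglongrightarrow> suminf (\<lambda>k. (1 / x) ^ k)"
  proof (rule tannerys_theorem[THEN conjunct2, THEN conjunct2])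
    show "(\<lambda>N. a k N) \<longlonglongrightarrow> (1 / x) ^ k" for k
    proof (rule LIMSEQ_offset[of _ k])
      have "(\<lambda>N. r N * (1 + real k / real N) * (1 / x) ^ k) \<longlonglongrightarrow> 1 * (1 + 0) * (1 / x) ^ k"
        by (intro tendsto_intros r lim_const_over_n)
      moreover have "\<forall>\<^sub>F N in sequentially. r N * (1 + real k / real N) * (1 / x) ^ k = a k (N + k)"
        by (rule eventually_mono[OF eventually_gt_at_top[of 0]])
          (simp add: a_def field_simps power_one_over)
      ultimately show "(\<lambda>N. a k (N + k)) \<longlonglongrightarrow> (1 / x) ^ k"
        using Lim_transform_eventually by fastforce
    qed
    show "\<forall>\<^sub>F (k, N) in sequentially \<times>\<^sub>F sequentially. norm (a k N) \<le> B * (real (Suc k) * (1 / x) ^ k)"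
    proof (rule always_eventually, clarify)
      fix k N
      show "norm (a k N) \<le> B * (real (Suc k) * (1 / x) ^ k)"
      proof (cases "k < N")
        case True
        define m where "m = N - k"
        have m: "N = m + k" "m > 0"
          using True by (simp_all add: m_def)
        have "k \<le> k * m"
          using m(2) by simp
        then have "real N \<le> real (Suc k) * real m"
          unfolding m(1) by (simp flip: of_nat_mult of_nat_add of_nat_Suc)
        then have "real N / real m \<le> real (Suc k)"
          using m(2) by (simp add: divide_le_eq)
        then have "norm (r m) * (real N / real m) * (1 / x) ^ k \<le> B * real (Suc k) * (1 / x) ^ k"
          using B x by (intro mult_right_mono mult_mono) auto
        moreover have "norm (a k N) = norm (r m) * (real N / real m) * (1 / x) ^ k"
          using True x by (simp add: a_def m_def abs_mult power_divide)
        ultimately show ?thesis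
          by (simp add: mult.assoc)
      next
        case False
        then show ?thesis
          using B x by (simp add: a_def)
      qed
    qed
    show "summable (\<lambda>k. B * (real (Suc k) * (1 / x) ^ k))"
      using x by (intro summable_mult sums_summable[OF geometric_deriv_sums]) simp
  qed simp
  moreover have "suminf (\<lambda>k. a k N) = real N * (\<Sum>n = 1..N. f n) / x ^ N" for N
  proof -
    have "suminf (\<lambda>k. a k N) = (\<Sum>k<N. a k N)"
      by (intro suminf_finite) (auto simp: a_def)
    also have "\<dots> = (\<Sum>k<N. real N * f (N - k) / x ^ N)"
    proof (rule sum.cong)
      fix k assume "k \<in> {..<N}"
      then have "k < N" by simp
      then have "x ^ N = x ^ (N - k) * x ^ k"
        by (simp flip: power_add)
      then show "a k N = real N * f (N - k) / x ^ N"
        using \<open>k < N\<close> by (simp add: a_def r_def)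
    qed simp
    also have "\<dots> = real N * (\<Sum>k<N. f (N - k)) / x ^ N"
      by (simp add: sum_distrib_left sum_divide_distrib)
    also have "(\<Sum>k<N. f (N - k)) = (\<Sum>k<N. f (Suc (N - Suc k)))"
      by (intro sum.cong) (auto simp: Suc_diff_Suc)
    also have "\<dots> = (\<Sum>k<N. f (Suc k))"
      by (rule sum.nat_diff_reindex)
    also have "\<dots> = (\<Sum>n = 1..N. f n)"
      by (intro sum.reindex_bij_witness[of _ "\<lambda>n. n - 1" Suc]) auto
    finally show ?thesis .
  qed
  moreover have "suminf (\<lambda>k. (1 / x) ^ k) = x / (x - 1)"
    using x by (subst suminf_geometric) (auto simp: field_simps)
  ultimately have "(\<lambda>N. real N * (\<Sum>n = 1..N. f n) / x ^ N) \<longlonglongrightarrow> x / (x - 1)"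
    by simp
  then have "(\<lambda>N. real N * (\<Sum>n = 1..N. f n) / x ^ N * ((x - 1) / x)) \<longlonglongrightarrow> x / (x - 1) * ((x - 1) / x)"
    by (rule tendsto_mult_right)
  moreover have "x / (x - 1) * ((x - 1) / x) = 1"
    using x by simp
  moreover have "real N * (\<Sum>n = 1..N. f n) / x ^ N * ((x - 1) / x)
      = (\<Sum>n = 1..N. f n) / (x ^ (N + 1) / ((x - 1) * real N))" for N
    by (simp add: field_simps)
  ultimately show ?thesis
    by (intro asymp_equivI') simp
qed

theorem theorem1p2:
  fixes d :: nat
  assumes "CARD('a::finite) = d"
    and "d \<ge> 2"
  shows "(\<lambda>N. real (free_lie_trunc_dim TYPE('a) N))
           \<sim>[sequentially] (\<lambda>N. real d ^ (N + 1) / ((real d - 1) * real N))"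
proof -
  obtain e :: "nat \<Rightarrow> 'a" where e: "bij_betw e {0..<d} UNIV"
    using ex_bij_betw_nat_finite[of "UNIV :: 'a set"] assms(1) by auto
  have "(\<lambda>N. \<Sum>n = 1..N. real (card (lyndon_words {0..<d} n)))
      \<sim>[sequentially] (\<lambda>N. real d ^ (N + 1) / ((real d - 1) * real N))"
    using assms(2) by (intro sum_asymp_equiv_power_over_index lyndon_words_asymp) auto
  then show ?thesis
    by (simp add: free_lie_trunc_dim_eq[OF e])
qed

end
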